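(* Let $d\geq 1$ and let $D$ be an oriented graph with no directed triangle, of minimum semi-degree $d$ and of order $n=md$ with $m\leq 3$. Then every vertex $x$ of $D$ is contained in more than $$\dfrac{11-15c+7c^2-c^3-(c^2-3c+3)m}{(1-c)^2(2-c)}\,d$$ directed cycles of length $4$.
   Context: Digraphs have no loops and no parallel arcs. An oriented graph is a digraph in which for any two distinct vertices $x,y$ at most one of $(x,y),(y,x)$ is an arc. The minimum semi-degree of $D$ is the minimum of its minimum out-degree and its minimum in-degree. A directed triangle is a directed cycle of length $3$. The constant $c$ denotes the minimum constant such that every digraph of order $n$ with minimum out-degree at least $cn$ contains a directed cycle of length at most $3$; it is known that $\frac13\leq c\leq 0.3465$. *)

theory Defs
  imports Complex_Main "Graph_Theory.Digraph" "Graph_Theory.Arc_Walk"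
begin

locale oriented_graph = digraph +
  assumes antisym_arcs: "x \<noteq> y \<Longrightarrow> \<not> (x \<rightarrow>\<^bsub>G\<^esub> y \<and> y \<rightarrow>\<^bsub>G\<^esub> x)"

definition min_out_degree :: "('a, 'b) pre_digraph \<Rightarrow> nat" where
  "min_out_degree G = Min (out_degree G ` verts G)"

definition min_in_degree :: "('a, 'b) pre_digraph \<Rightarrow> nat" where
  "min_in_degree G = Min (in_degree G ` verts G)"

definition min_semidegree :: "('a, 'b) pre_digraph \<Rightarrow> nat" where
  "min_semidegree G = min (min_out_degree G) (min_in_degree G)"

text \<open>
  The predicate \<open>pre_digraph.cycle\<close> describes rooted closed walks, so the \<open>k\<close> rotations of a
  walk all trace the same directed cycle. A directed cycle is therefore identified with its set
  of arcs, which makes counting independent of the starting point. The vertices of a cycle are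
  the tails of its arcs.
\<close>

definition dicycles :: "('a, 'b) pre_digraph \<Rightarrow> nat \<Rightarrow> 'b set set" where
  "dicycles G k = {set p | p. pre_digraph.cycle G p \<and> length p = k}"

definition dicycles_through :: "('a, 'b) pre_digraph \<Rightarrow> nat \<Rightarrow> 'a \<Rightarrow> 'b set set" where
  "dicycles_through G k x = {C \<in> dicycles G k. x \<in> tail G ` C}"

text \<open>
  Every finite digraph is isomorphic to one with vertices and arcs of type \<^typ>\<open>nat\<close>, so
  quantifying over these covers all finite digraphs. The null digraph has to be excluded: it
  contains no cycle at all.
\<close>

definition forces_short_dicycle :: "real \<Rightarrow> bool" where
  "forces_short_dicycle c \<longleftrightarrow>
     (\<forall>G :: (nat, nat) pre_digraph.
        digraph G \<longrightarrow> verts G \<noteq> {} \<longrightarrow> c * real (card (verts G)) \<le> real (min_out_degree G) \<longrightarrow>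
        (\<exists>k \<le> 3. dicycles G k \<noteq> {}))"

text \<open>
  The least such constant exists. The set of these constants is upward closed, contains \<open>1\<close>, and
  contains no number \<open>\<le> 1/4\<close> (directed 4-cycle). If its infimum \<open>c\<close> were not attained,
  there would be a digraph \<open>G\<close> of order \<open>n\<close> without directed cycles of length at most 3 and with
  minimum out-degree \<open>\<delta> \<ge> c n > 0\<close>; the lexicographic product \<open>G[G]\<close> has no such cycles
  either, order \<open>n\<^sup>2\<close> and minimum out-degree \<open>\<delta> (n + 1) > c n\<^sup>2\<close>, contradicting the choice of \<open>c\<close>.
\<close>

definition ch_const :: real where
  "ch_const = (LEAST c. forces_short_dicycle c)"

end

theory Submission
  imports Defs
begin

text \<open>
  Let \<open>X\<close> and \<open>Y\<close> be the out- and in-neighbourhood of \<open>x\<close>, let \<open>R\<close> be the set of the remaining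
  vertices other than \<open>x\<close>, and put \<open>t = 1 - c\<close>. As there is no directed triangle, no arc goes from
  \<open>X\<close> to \<open>Y\<close>, so an out-neighbour of a vertex of \<open>X\<close> lies in \<open>X \<union> R\<close> and an in-neighbour of a
  vertex of \<open>Y\<close> lies in \<open>Y \<union> R\<close>. By the choice of \<open>c\<close>, some \<open>v \<in> Y\<close> has fewer than \<open>c |Y|\<close>
  in-neighbours in \<open>Y\<close>, hence more than \<open>d - c |Y|\<close> in \<open>R\<close>. Greedily removing vertices of small
  out-degree yields \<open>k\<close> vertices of \<open>X\<close>, the \<open>i\<close>-th of which (\<open>i = 0, 1, \<dots>\<close>) has fewer than
  \<open>c |X| + t i\<close> out-neighbours in \<open>X\<close>. Since \<open>|R| = n - 1 - |X| - |Y|\<close>, comparing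
  neighbourhoods inside \<open>R\<close> gives more than \<open>k (2 d - n + 1 + 2 t d) - t k (k - 1) / 2\<close> directed
  4-cycles through \<open>x\<close> and \<open>v\<close>. The same comparison shows \<open>n > (2 + t) d + 1\<close>, which for
  \<open>n \<le> 3 d\<close> and \<open>c \<le> 1/2\<close> leaves only \<open>d \<ge> 4\<close>, where \<open>k = 4\<close> suffices, and \<open>d = 3\<close>,
  \<open>n = 9\<close>, where \<open>k = 3\<close> suffices.
\<close>

section \<open>Relations without directed cycles of length at most 3\<close>

text \<open>The case \<open>u = v\<close> of the first clause excludes loops.\<close>

definition no_short_dicycle :: "'a set \<Rightarrow> ('a \<Rightarrow> 'a \<Rightarrow> bool) \<Rightarrow> bool" where
  "no_short_dicycle V r \<longleftrightarrow>
     (\<forall>u\<in>V. \<forall>v\<in>V. \<not> (r u v \<and> r v u)) \<and>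
     (\<forall>u\<in>V. \<forall>v\<in>V. \<forall>w\<in>V. \<not> (r u v \<and> r v w \<and> r w u))"

lemma no_short_dicycle_irrefl: "no_short_dicycle V r \<Longrightarrow> u \<in> V \<Longrightarrow> \<not> r u u"
  unfolding no_short_dicycle_def by blast

lemma no_short_dicycle_antisym: "no_short_dicycle V r \<Longrightarrow> u \<in> V \<Longrightarrow> v \<in> V \<Longrightarrow> r u v \<Longrightarrow> \<not> r v u"
  unfolding no_short_dicycle_def by blast

lemma no_short_dicycle_triangle:
  "no_short_dicycle V r \<Longrightarrow> u \<in> V \<Longrightarrow> v \<in> V \<Longrightarrow> w \<in> V \<Longrightarrow> r u v \<Longrightarrow> r v w \<Longrightarrow> \<not> r w u"
  unfolding no_short_dicycle_def by blast

lemma no_short_dicycle_subset: "no_short_dicycle V r \<Longrightarrow> W \<subseteq> V \<Longrightarrow> no_short_dicycle W r"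
  unfolding no_short_dicycle_def by blast

lemma no_short_dicycle_converse: "no_short_dicycle V r \<Longrightarrow> no_short_dicycle V (\<lambda>u v. r v u)"
  unfolding no_short_dicycle_def by blast

section \<open>Translation from arc lists to the adjacency relation\<close>

lemma cycle_iff_cas:
  "pre_digraph.cycle G p \<longleftrightarrow> (\<exists>u \<in> verts G. set p \<subseteq> arcs G \<and> pre_digraph.cas G u p u \<and>
     distinct (tl (pre_digraph.awalk_verts G u p)) \<and> p \<noteq> [])"
  by (auto simp: pre_digraph.cycle_def pre_digraph.awalk_def)

lemma (in digraph) out_degree_conv_card: "out_degree G u = card {w \<in> verts G. u \<rightarrow> w}"
proof -
  have "inj_on (head G) (out_arcs G u)"
    by (auto intro!: inj_onI no_multi_arcs simp: arc_to_ends_def)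
  moreover have "head G ` out_arcs G u = {w \<in> verts G. u \<rightarrow> w}"
    by (auto simp: arcs_ends_conv)
  ultimately show ?thesis
    unfolding out_degree_def by (metis card_image)
qed

lemma (in digraph) in_degree_conv_card: "in_degree G u = card {w \<in> verts G. w \<rightarrow> u}"
proof -
  have "inj_on (tail G) (in_arcs G u)"
    by (auto intro!: inj_onI no_multi_arcs simp: arc_to_ends_def)
  moreover have "tail G ` in_arcs G u = {w \<in> verts G. w \<rightarrow> u}"
    by (auto simp: arcs_ends_conv)
  ultimately show ?thesis
    unfolding in_degree_def by (metis card_image)
qed

lemma (in digraph) dicycles_2_nonempty:
  assumes "u \<rightarrow> v" "v \<rightarrow> u"
  shows "dicycles G 2 \<noteq> {}"
proof -
  obtain e f where "e \<in> arcs G" "tail G e = u" "head G e = v" "f \<in> arcs G" "tail G f = v" "head G f = u"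
    using assms by (auto simp: arcs_ends_conv)
  then have "cycle [e, f]"
    using no_loops[of e] unfolding cycle_iff_cas by auto
  then have "set [e, f] \<in> dicycles G 2"
    unfolding dicycles_def by (force simp: numeral_2_eq_2)
  then show ?thesis by blast
qed

lemma (in digraph) dicycles_3_nonempty:
  assumes "u \<rightarrow> v" "v \<rightarrow> w" "w \<rightarrow> u"
  shows "dicycles G 3 \<noteq> {}"
proof -
  obtain e f g where e: "e \<in> arcs G" "tail G e = u" "head G e = v"
    and f: "f \<in> arcs G" "tail G f = v" "head G f = w"
    and g: "g \<in> arcs G" "tail G g = w" "head G g = u"
    using assms by (auto simp: arcs_ends_conv)
  then have "cycle [e, f, g]"
    using no_loops[of e] no_loops[of f] no_loops[of g] unfolding cycle_iff_cas
    by auto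
  then have "set [e, f, g] \<in> dicycles G 3"
    unfolding dicycles_def by (force simp: numeral_3_eq_3)
  then show ?thesis by blast
qed

text \<open>Cycles are nonempty and there are no loops, so lengths 0 and 1 never occur; the two
  clauses of \<open>no_short_dicycle\<close> account for lengths 2 and 3.\<close>

lemma (in digraph) no_short_dicycle_iff:
  "no_short_dicycle (verts G) (dominates G) \<longleftrightarrow> (\<forall>k\<le>3. dicycles G k = {})"
proof
  assume "\<forall>k\<le>3. dicycles G k = {}"
  then show "no_short_dicycle (verts G) (dominates G)"
    unfolding no_short_dicycle_def using dicycles_2_nonempty dicycles_3_nonempty
    by (metis order_refl numeral_le_iff semiring_norm(68,69,71,72))
next
  assume free: "no_short_dicycle (verts G) (dominates G)"
  have "length p > 3" if "cycle p" for p
  proof (rule ccontr)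
    assume "\<not> length p > 3"
    moreover have "p \<noteq> []"
      using that by (auto simp: cycle_iff_cas)
    ultimately consider e where "p = [e]" | e f where "p = [e, f]" | e f g where "p = [e, f, g]"
      using \<open>p \<noteq> []\<close> by (auto simp: neq_Nil_conv not_less numeral_3_eq_3 le_Suc_eq length_Suc_conv)
    then show False
    proof cases
      case (1 e)
      then show False using that no_loops[of e] by (auto simp: cycle_iff_cas)
    next
      case (2 e f)
      then have "e \<in> arcs G" "f \<in> arcs G" "head G e = tail G f" "head G f = tail G e"
        using that by (auto simp: cycle_iff_cas)
      moreover from this have "tail G e \<rightarrow> tail G f" "tail G f \<rightarrow> tail G e"
        by (metis dominatesI arc_to_ends_def)+
      ultimately show False
        using no_short_dicycle_antisym[OF free] by (metis tail_in_verts)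
    next
      case (3 e f g)
      then have "e \<in> arcs G" "f \<in> arcs G" "g \<in> arcs G"
        "head G e = tail G f" "head G f = tail G g" "head G g = tail G e"
        using that by (auto simp: cycle_iff_cas)
      moreover from this have "tail G e \<rightarrow> tail G f" "tail G f \<rightarrow> tail G g" "tail G g \<rightarrow> tail G e"
        by (metis dominatesI arc_to_ends_def)+
      ultimately show False
        using no_short_dicycle_triangle[OF free] by (metis tail_in_verts)
    qed
  qed
  then show "\<forall>k\<le>3. dicycles G k = {}"
    by (force simp: dicycles_def)
qed

lemma (in digraph) le_min_out_degree_iff:
  assumes "verts G \<noteq> {}"
  shows "a \<le> real (min_out_degree G) \<longleftrightarrow> (\<forall>u \<in> verts G. a \<le> real (card {w \<in> verts G. u \<rightarrow> w}))"
proof -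
  have fin: "finite (out_degree G ` verts G)" "out_degree G ` verts G \<noteq> {}"
    using assms by auto
  have "min_out_degree G \<in> out_degree G ` verts G"
    unfolding min_out_degree_def by (rule Min_in[OF fin])
  moreover have "min_out_degree G \<le> out_degree G u" if "u \<in> verts G" for u
    unfolding min_out_degree_def by (rule Min_le[OF fin(1)]) (use that in auto)
  ultimately show ?thesis
    unfolding out_degree_conv_card[symmetric] by (force intro: order_trans)
qed

section \<open>The forcing property for relations on arbitrary types\<close>

text \<open>Contrapositive of the definition, so that a constant can be verified on plain
  relations.\<close>

lemma forces_short_dicycleI:
  assumes "\<And>(V :: nat set) r. finite V \<Longrightarrow> V \<noteq> {} \<Longrightarrow> no_short_dicycle V r \<Longrightarrow>
    \<exists>u\<in>V. real (card {w \<in> V. r u w}) < c * real (card V)"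
  shows "forces_short_dicycle c"
  unfolding forces_short_dicycle_def
proof (intro allI impI)
  fix G :: "(nat, nat) pre_digraph"
  assume "digraph G" and ne: "verts G \<noteq> {}" and deg: "c * real (card (verts G)) \<le> real (min_out_degree G)"
  then interpret digraph G by simp
  have "\<not> no_short_dicycle (verts G) (dominates G)"
    using assms[OF finite_verts ne] deg le_min_out_degree_iff[OF ne] by (meson not_le)
  then show "\<exists>k\<le>3. dicycles G k \<noteq> {}"
    using no_short_dicycle_iff by blast
qed

text \<open>The definition speaks of digraphs over \<open>nat\<close> only. The relation is
  therefore moved along an injection \<open>f\<close> of \<open>V\<close> into \<open>nat\<close>,
  with each arc coded by the pair of its ends. The free type \<open>'a\<close> makes the result
  applicable to vertex subsets of any digraph.\<close>

lemma forces_short_dicycleD: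
  fixes V :: "'a set"
  assumes forces: "forces_short_dicycle c"
    and fin: "finite V" and ne: "V \<noteq> {}" and free: "no_short_dicycle V r"
  shows "\<exists>u\<in>V. real (card {w \<in> V. r u w}) < c * real (card V)"
proof (rule ccontr)
  assume neg: "\<not> ?thesis"
  obtain f :: "'a \<Rightarrow> nat" where f: "inj_on f V"
    using finite_imp_inj_to_nat_seg[OF fin] by auto
  define A where "A = {(u, v). u \<in> V \<and> v \<in> V \<and> r u v}"
  define G :: "(nat, nat) pre_digraph" where
    "G = \<lparr>verts = f ` V, arcs = (\<lambda>(u, v). prod_encode (f u, f v)) ` A,
          tail = fst \<circ> prod_decode, head = snd \<circ> prod_decode\<rparr>"
  have G [simp]: "verts G = f ` V" "arcs G = (\<lambda>(u, v). prod_encode (f u, f v)) ` A"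
    "tail G = fst \<circ> prod_decode" "head G = snd \<circ> prod_decode"
    by (auto simp: G_def)
  have fin_A: "finite A"
    by (rule finite_subset[of _ "V \<times> V"]) (use fin in \<open>auto simp: A_def\<close>)
  have A_neq: "f u \<noteq> f v" if "(u, v) \<in> A" for u v
    using that f no_short_dicycle_irrefl[OF free] by (auto simp: A_def inj_on_eq_iff)
  interpret digraph G
  proof unfold_locales
    show "tail G e \<in> verts G" "head G e \<in> verts G" if "e \<in> arcs G" for e
      using that by (auto simp: A_def)
    show "tail G e \<noteq> head G e" if "e \<in> arcs G" for e
      using that A_neq by auto
  qed (use fin fin_A in \<open>auto simp: arc_to_ends_def\<close>)
  have dom: "f u \<rightarrow>\<^bsub>G\<^esub> f v \<longleftrightarrow> r u v" if "u \<in> V" "v \<in> V" for u v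
  proof -
    have "arcs_ends G = (\<lambda>(u, v). (f u, f v)) ` A"
      by (auto simp: arcs_ends_conv image_image case_prod_unfold)
    moreover have "r u v" if im: "(f u, f v) \<in> (\<lambda>(u, v). (f u, f v)) ` A"
    proof -
      obtain a b where "(a, b) \<in> A" "f u = f a" "f v = f b"
        using im by auto
      then have "u = a" "v = b" "r a b"
        using \<open>u \<in> V\<close> \<open>v \<in> V\<close> f by (auto simp: A_def inj_on_eq_iff)
      then show ?thesis by simp
    qed
    moreover have "(f u, f v) \<in> (\<lambda>(u, v). (f u, f v)) ` A" if "r u v"
      using that \<open>u \<in> V\<close> \<open>v \<in> V\<close> by (intro image_eqI[of _ _ "(u, v)"]) (auto simp: A_def)
    ultimately show ?thesis by blast
  qed
  have free_G: "no_short_dicycle (verts G) (dominates G)"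
  proof -
    have "no_short_dicycle (f ` V) (dominates G) \<longleftrightarrow> no_short_dicycle V r"
      unfolding no_short_dicycle_def by (simp only: ball_simps dom cong: ball_cong)
    then show ?thesis using free by simp
  qed
  have "card {w \<in> verts G. f u \<rightarrow>\<^bsub>G\<^esub> w} = card {w \<in> V. r u w}" if "u \<in> V" for u
  proof -
    have "{w \<in> verts G. f u \<rightarrow>\<^bsub>G\<^esub> w} = f ` {w \<in> V. r u w}"
      using that by (auto simp: dom)
    moreover have "inj_on f {w \<in> V. r u w}"
      using f by (rule inj_on_subset) auto
    ultimately show ?thesis by (simp only: card_image)
  qed
  moreover have "card (verts G) = card V"
    using f by (simp add: card_image)
  ultimately have "c * real (card (verts G)) \<le> real (min_out_degree G)"
    using neg ne by (subst le_min_out_degree_iff) (auto simp: not_less simp del: G(2-4))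
  moreover have "verts G \<noteq> {}"
    using ne by simp
  ultimately have "\<exists>k\<le>3. dicycles G k \<noteq> {}"
    using forces digraph_axioms unfolding forces_short_dicycle_def by blast
  then show False
    using free_G no_short_dicycle_iff by blast
qed

section \<open>Bounds on the constant, and attainment of the infimum\<close>

text \<open>Arcs, reversed arcs and the diagonal are pairwise disjoint in
  \<open>V \<times> V\<close>, whereas out-degrees of at least half the order would let the first
  two alone fill \<open>V \<times> V\<close>.\<close>

lemma forces_short_dicycle_half: "forces_short_dicycle (1/2)"
proof (rule forces_short_dicycleI)
  fix V :: "nat set" and r
  assume fin: "finite V" and ne: "V \<noteq> {}" and free: "no_short_dicycle V r"
  define E where "E = Sigma V (\<lambda>u. {w \<in> V. r u w})"
  have E: "E \<subseteq> V \<times> V"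
    by (auto simp: E_def)
  then have fin_E: "finite E"
    using fin finite_subset by blast
  have "E \<inter> E\<inverse> = {}" "(E \<union> E\<inverse>) \<inter> (\<lambda>v. (v, v)) ` V = {}"
    using no_short_dicycle_antisym[OF free] no_short_dicycle_irrefl[OF free] unfolding E_def by blast+
  then have "card E + card E + card V = card (E \<union> E\<inverse> \<union> (\<lambda>v. (v, v)) ` V)"
    using fin fin_E by (simp add: card_Un_disjoint card_image inj_on_def)
  also have "\<dots> \<le> card (V \<times> V)"
    using E fin by (intro card_mono) auto
  also have "\<dots> = card V * card V"
    by (rule card_cartesian_product)
  finally have upper: "2 * card E + card V \<le> card V * card V" by simp
  show "\<exists>u\<in>V. real (card {w \<in> V. r u w}) < 1/2 * real (card V)"
  proof (rule ccontr)
    assume "\<not> ?thesis"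
    then have "card V \<le> 2 * card {w \<in> V. r u w}" if "u \<in> V" for u
      using that by (fastforce simp: not_less)
    then have "(\<Sum>u\<in>V. card V) \<le> (\<Sum>u\<in>V. 2 * card {w \<in> V. r u w})"
      by (intro sum_mono) auto
    also have "\<dots> = 2 * card E"
      unfolding E_def using fin by (simp add: sum_distrib_left)
    finally have "card V * card V \<le> 2 * card E" by simp
    then have "card V = 0"
      using upper by linarith
    then show False
      using fin ne by simp
  qed
qed

lemma forces_short_dicycle_gt_quarter:
  assumes "forces_short_dicycle c"
  shows "1/4 < c"
proof -
  \<comment> \<open>the directed 4-cycle\<close>
  define V where "V = {0, 1, 2, 3 :: nat}"
  define r where "r = (\<lambda>u v :: nat. v = (u + 1) mod 4)"
  have "no_short_dicycle V r"
    by (simp add: no_short_dicycle_def V_def r_def)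
  then obtain u where "u \<in> V" "real (card {w \<in> V. r u w}) < c * real (card V)"
    using forces_short_dicycleD[OF assms, of V r] by (auto simp: V_def)
  moreover have "{w \<in> V. r u w} = {(u + 1) mod 4}"
    using \<open>u \<in> V\<close> by (auto simp: V_def r_def)
  ultimately show ?thesis
    by (simp add: V_def)
qed

lemma bdd_below_forces: "bdd_below {c. forces_short_dicycle c}"
  using forces_short_dicycle_gt_quarter by (auto intro!: bdd_belowI[of _ "1/4"] less_imp_le)

text \<open>A short cycle either stays over one point of \<open>V\<close>, giving a short cycle of
  \<open>s\<close>, or projects to a closed walk of \<open>r\<close> of length at most 3.\<close>

lemma no_short_dicycle_lex:
  assumes "no_short_dicycle V r" "no_short_dicycle W s"
  shows "no_short_dicycle (V \<times> W) (\<lambda>(a, b) (a', b'). r a a' \<or> a = a' \<and> s b b')"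
  unfolding no_short_dicycle_def
proof (intro conjI ballI, goal_cases)
  case (1 p q)
  obtain a b a' b' where pq: "p = (a, b)" "q = (a', b')" by (metis surj_pair)
  then have "a \<in> V" "a' \<in> V" "b \<in> W" "b' \<in> W"
    using 1 by auto
  then show ?case
    unfolding pq prod.case
    using assms[THEN no_short_dicycle_antisym] assms[THEN no_short_dicycle_irrefl] by blast
next
  case (2 p q t)
  obtain a b a' b' a'' b'' where pq: "p = (a, b)" "q = (a', b')" "t = (a'', b'')" by (metis surj_pair)
  then have "a \<in> V" "a' \<in> V" "a'' \<in> V" "b \<in> W" "b' \<in> W" "b'' \<in> W"
    using 2 by auto
  then show ?case
    unfolding pq prod.case
    using assms[THEN no_short_dicycle_antisym] assms[THEN no_short_dicycle_irrefl]
      assms[THEN no_short_dicycle_triangle] by metis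
qed

text \<open>The out-neighbourhood consists of full copies of \<open>W\<close> over the
  out-neighbours of \<open>a\<close> and a part over \<open>a\<close> itself; irreflexivity at
  \<open>a\<close> keeps them disjoint.\<close>

lemma card_lex_out:
  assumes "finite V" "finite W" "a \<in> V" "b \<in> W" "\<not> r a a"
  shows "card {(a', b') \<in> V \<times> W. r a a' \<or> a = a' \<and> s b b'} =
    card {a' \<in> V. r a a'} * card W + card {b' \<in> W. s b b'}"
proof -
  have "{(a', b') \<in> V \<times> W. r a a' \<or> a = a' \<and> s b b'} =
    {a' \<in> V. r a a'} \<times> W \<union> {a} \<times> {b' \<in> W. s b b'}"
    using assms by auto
  also have "card \<dots> = card ({a' \<in> V. r a a'} \<times> W) + card ({a} \<times> {b' \<in> W. s b b'})"
    using assms by (intro card_Un_disjoint) auto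
  finally show ?thesis
    by (simp add: card_cartesian_product)
qed

text \<open>
  If the infimum were not attained, the lexicographic square of a counterexample would have
  relative minimum out-degree strictly above the infimum.
\<close>
lemma forces_short_dicycle_Inf: "forces_short_dicycle (Inf {c. forces_short_dicycle c})"
proof (rule forces_short_dicycleI, rule ccontr)
  let ?S = "{c. forces_short_dicycle c}"
  fix V :: "nat set" and r
  assume fin: "finite V" and ne: "V \<noteq> {}" and free: "no_short_dicycle V r"
    and neg: "\<not> (\<exists>u\<in>V. real (card {w \<in> V. r u w}) < Inf ?S * real (card V))"
  define i where "i = Inf ?S"
  define n where "n = real (card V)"
  have n: "n > 0"
    using fin ne by (simp add: n_def card_gt_0_iff)
  have S: "?S \<noteq> {}" "bdd_below ?S"
    using forces_short_dicycle_half bdd_below_forces by auto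
  have "1/4 \<le> i"
    unfolding i_def using S(1) forces_short_dicycle_gt_quarter by (intro cInf_greatest) (auto intro: less_imp_le)
  \<comment> \<open>In the square all out-degrees are at least \<open>i * n * n + i * n\<close>, a
    proportion \<open>i + i / n\<close> of the order. As \<open>i\<close> is positive, some forcing
    constant lies below this.\<close>
  then have "i < i + i / n"
    using n by simp
  then obtain c where c: "forces_short_dicycle c" "c < i + i / n"
    using cInf_lessD[OF S(1), of "i + i / n"] by (auto simp: i_def)
  let ?lex = "\<lambda>(a, b) (a', b'). r a a' \<or> a = a' \<and> r b b'"
  obtain a b where ab: "a \<in> V" "b \<in> V"
    and lt: "real (card {w \<in> V \<times> V. ?lex (a, b) w}) < c * real (card (V \<times> V))"
    using forces_short_dicycleD[OF c(1) _ _ no_short_dicycle_lex[OF free free]] fin ne by auto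
  have "{w \<in> V \<times> V. ?lex (a, b) w} = {(a', b') \<in> V \<times> V. r a a' \<or> a = a' \<and> r b b'}"
    by auto
  then have "real (card {w \<in> V \<times> V. ?lex (a, b) w}) =
      real (card {a' \<in> V. r a a'}) * n + real (card {b' \<in> V. r b b'})"
    using card_lex_out[OF fin fin ab] no_short_dicycle_irrefl[OF free ab(1)] by (simp add: n_def)
  moreover have "i * n \<le> real (card {a' \<in> V. r a a'})" "i * n \<le> real (card {b' \<in> V. r b b'})"
    using neg ab unfolding i_def by (auto simp: not_less n_def)
  moreover from this(1) have "i * n * n \<le> real (card {a' \<in> V. r a a'}) * n"
    using n by (intro mult_right_mono) auto
  moreover have "real (card (V \<times> V)) = n * n"
    by (simp add: card_cartesian_product n_def)
  ultimately have "i * n * n + i * n < c * (n * n)"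
    using lt by simp
  moreover have "c * (n * n) < (i + i / n) * (n * n)"
    using c(2) n by (intro mult_strict_right_mono) auto
  moreover have "(i + i / n) * (n * n) = i * n * n + i * n"
    using n by (simp add: field_simps)
  ultimately show False by linarith
qed

lemma ch_const_eq_Inf: "ch_const = Inf {c. forces_short_dicycle c}"
  unfolding ch_const_def
  by (rule Least_equality, rule forces_short_dicycle_Inf) (simp add: cInf_lower bdd_below_forces)

lemma forces_short_dicycle_ch_const: "forces_short_dicycle ch_const"
  using forces_short_dicycle_Inf ch_const_eq_Inf by simp

lemma ch_const_le: "forces_short_dicycle c \<Longrightarrow> ch_const \<le> c"
  unfolding ch_const_eq_Inf by (simp add: cInf_lower bdd_below_forces)

section \<open>Greedy selection and neighbourhood counting\<close>

text \<open>With \<open>k\<close> vertices chosen, the next has fewer than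
  \<open>c * (card X - k)\<close> out-neighbours among the unchosen ones and at most
  \<open>k\<close> among the chosen. Summing these bounds \<open>c * card X + (1 - c) * k\<close>
  gives the arithmetic series.\<close>

lemma exists_low_out_degree_subset:
  fixes c :: real
  assumes fin: "finite X"
    and low: "\<And>W. W \<subseteq> X \<Longrightarrow> W \<noteq> {} \<Longrightarrow> \<exists>u\<in>W. real (card {w \<in> W. r u w}) < c * real (card W)"
    and k: "k \<le> card X"
  shows "\<exists>U\<subseteq>X. card U = k \<and>
    (\<Sum>u\<in>U. real (card {w \<in> X. r u w})) \<le> c * real k * real (card X) + (1 - c) * real k * (real k - 1) / 2"
  using k
proof (induction k)
  case 0
  show ?case by (intro exI[of _ "{}"]) auto
next
  case (Suc k)
  then obtain U where U: "U \<subseteq> X" "card U = k"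
    and sum: "(\<Sum>u\<in>U. real (card {w \<in> X. r u w})) \<le> c * real k * real (card X) + (1 - c) * real k * (real k - 1) / 2"
    by auto
  have fin_U: "finite U"
    using U(1) fin finite_subset by blast
  have card: "card (X - U) = card X - k"
    using U fin_U by (simp add: card_Diff_subset)
  then have "X - U \<noteq> {}"
    using Suc.prems by (metis card.empty diff_is_0_eq not_less_eq_eq)
  then obtain u where u: "u \<in> X - U" and lt: "real (card {w \<in> X - U. r u w}) < c * real (card (X - U))"
    using low[of "X - U"] by blast
  have "{w \<in> X. r u w} \<subseteq> {w \<in> X - U. r u w} \<union> U"
    by auto
  then have "card {w \<in> X. r u w} \<le> card ({w \<in> X - U. r u w} \<union> U)"
    using fin fin_U by (intro card_mono) auto
  also have "\<dots> \<le> card {w \<in> X - U. r u w} + k"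
    unfolding U(2)[symmetric] by (rule card_Un_le)
  finally have "real (card {w \<in> X. r u w}) \<le> c * (real (card X) - real k) + real k"
    using lt card Suc.prems by (simp add: of_nat_diff)
  then have "(\<Sum>u\<in>insert u U. real (card {w \<in> X. r u w})) \<le>
      c * real (Suc k) * real (card X) + (1 - c) * real (Suc k) * (real (Suc k) - 1) / 2"
    using sum u fin_U by (simp add: field_simps)
  moreover have "insert u U \<subseteq> X" "card (insert u U) = Suc k"
    using u U fin_U by auto
  ultimately show ?case by blast
qed

text \<open>The choice of \<open>c\<close> enters only through \<open>low_out\<close> and
  \<open>low_in\<close>. They range over all subsets because they are applied to neighbourhoods and
  to what the greedy selection leaves of them.\<close>

locale low_degree_relation =
  fixes V :: "'a set" and r :: "'a \<Rightarrow> 'a \<Rightarrow> bool" and c :: real and d :: nat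
  assumes fin: "finite V"
    and free: "no_short_dicycle V r"
    and low_out: "\<And>W. W \<subseteq> V \<Longrightarrow> W \<noteq> {} \<Longrightarrow> \<exists>u\<in>W. real (card {w \<in> W. r u w}) < c * real (card W)"
    and low_in: "\<And>W. W \<subseteq> V \<Longrightarrow> W \<noteq> {} \<Longrightarrow> \<exists>u\<in>W. real (card {w \<in> W. r w u}) < c * real (card W)"
    and out_ge: "\<And>u. u \<in> V \<Longrightarrow> d \<le> card {w \<in> V. r u w}"
    and in_ge: "\<And>u. u \<in> V \<Longrightarrow> d \<le> card {w \<in> V. r w u}"
    and d_pos: "1 \<le> d"
    and c_le_1: "c \<le> 1"
begin

text \<open>At the vertex \<open>x\<close> these are the sets \<open>X\<close>, \<open>Y\<close> and
  \<open>R\<close> of the proof idea.\<close>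

definition "outs u = {w \<in> V. r u w}"
definition "ins u = {w \<in> V. r w u}"
definition "rest u = V - insert u (outs u \<union> ins u)"

lemma finite_nbhds [simp]: "finite (outs u)" "finite (ins u)" "finite (rest u)"
  using fin by (auto simp: outs_def ins_def rest_def)

lemma card_rest:
  assumes x: "x \<in> V"
  shows "real (card (rest x)) = real (card V) - 1 - real (card (outs x)) - real (card (ins x))"
proof -
  have disj: "outs x \<inter> ins x = {}"
    using no_short_dicycle_antisym[OF free] x unfolding outs_def ins_def by blast
  have "x \<notin> outs x \<union> ins x"
    using no_short_dicycle_irrefl[OF free x] unfolding outs_def ins_def by blast
  then have "card (insert x (outs x \<union> ins x)) = Suc (card (outs x) + card (ins x))"
    using disj by (simp add: card_Un_disjoint)
  moreover have sub: "insert x (outs x \<union> ins x) \<subseteq> V"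
    using x by (auto simp: outs_def ins_def)
  moreover have "card (insert x (outs x \<union> ins x)) \<le> card V"
    using card_mono[OF fin sub] .
  ultimately show ?thesis
    unfolding rest_def by (simp add: card_Diff_subset of_nat_diff)
qed

text \<open>An arc from \<open>u\<close> to \<open>x\<close> would close a 2-cycle, and one to an
  in-neighbour of \<open>x\<close> a triangle.\<close>

lemma outs_subset:
  assumes x: "x \<in> V" and u: "u \<in> outs x"
  shows "outs u \<subseteq> {w \<in> outs x. r u w} \<union> outs u \<inter> rest x"
proof
  fix w assume w: "w \<in> outs u"
  have "u \<in> V" "r x u" "w \<in> V" "r u w"
    using u w by (auto simp: outs_def)
  then have "w \<noteq> x" "w \<notin> ins x"
    using no_short_dicycle_antisym[OF free] no_short_dicycle_triangle[OF free] x
    unfolding ins_def by blast+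
  then show "w \<in> {w \<in> outs x. r u w} \<union> outs u \<inter> rest x"
    using w \<open>w \<in> V\<close> \<open>r u w\<close> unfolding rest_def by blast
qed

lemma ins_subset:
  assumes x: "x \<in> V" and v: "v \<in> ins x"
  shows "ins v \<subseteq> {w \<in> ins x. r w v} \<union> ins v \<inter> rest x"
proof
  fix w assume w: "w \<in> ins v"
  have "v \<in> V" "r v x" "w \<in> V" "r w v"
    using v w by (auto simp: ins_def)
  then have "w \<noteq> x" "w \<notin> outs x"
    using no_short_dicycle_antisym[OF free] no_short_dicycle_triangle[OF free] x
    unfolding outs_def by blast+
  then show "w \<in> {w \<in> ins x. r w v} \<union> ins v \<inter> rest x"
    using w \<open>w \<in> V\<close> \<open>r w v\<close> unfolding rest_def by blast
qed

lemma outs_ge: "u \<in> V \<Longrightarrow> d \<le> card (outs u)" and ins_ge: "u \<in> V \<Longrightarrow> d \<le> card (ins u)"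
  using out_ge in_ge by (auto simp: outs_def ins_def)

lemma obtain_low_in:
  assumes x: "x \<in> V"
  obtains v where "v \<in> ins x" "real d - c * real (card (ins x)) < real (card (ins v \<inter> rest x))"
proof -
  have "ins x \<subseteq> V" "ins x \<noteq> {}"
    using ins_ge[OF x] d_pos unfolding ins_def by (blast, force)
  then obtain v where v: "v \<in> ins x" and lt: "real (card {w \<in> ins x. r w v}) < c * real (card (ins x))"
    using low_in by blast
  have "d \<le> card (ins v)"
    using v by (intro ins_ge) (auto simp: ins_def)
  also have "\<dots> \<le> card ({w \<in> ins x. r w v} \<union> ins v \<inter> rest x)"
    by (intro card_mono ins_subset x v) simp
  also have "\<dots> \<le> card {w \<in> ins x. r w v} + card (ins v \<inter> rest x)"
    by (rule card_Un_le)
  finally have "real d - c * real (card (ins x)) < real (card (ins v \<inter> rest x))"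
    using lt by linarith
  with v show ?thesis by (rule that)
qed

text \<open>The set \<open>rest x\<close> has room for more than \<open>d - c * card (ins x)\<close>
  vertices; both neighbourhoods of \<open>x\<close> have at least \<open>d\<close> elements and
  enter the order with the nonnegative coefficients \<open>1\<close> and
  \<open>1 - c\<close>.\<close>

lemma order_gt:
  assumes x: "x \<in> V"
  shows "1 + (3 - c) * real d < real (card V)"
proof -
  obtain v where v: "real d - c * real (card (ins x)) < real (card (ins v \<inter> rest x))"
    using obtain_low_in[OF x] .
  have "card (ins v \<inter> rest x) \<le> card (rest x)"
    by (intro card_mono) auto
  moreover have "(1 - c) * real d \<le> (1 - c) * real (card (ins x))"
    using ins_ge[OF x] c_le_1 by (intro mult_left_mono) auto
  ultimately show ?thesis
    using v outs_ge[OF x] card_rest[OF x] by (simp add: algebra_simps)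
qed

lemma card_four_cycles_gt:
  assumes x: "x \<in> V" and k: "1 \<le> k" "k \<le> d"
  shows "real k * (2 * real d + 2 * (1 - c) * real d + 1 - real (card V)) - (1 - c) * real k * (real k - 1) / 2
    < real (card {(u, w, v). u \<in> outs x \<and> w \<in> outs u \<and> v \<in> outs w \<and> x \<in> outs v})"
proof -
  obtain v where v: "v \<in> ins x" and v_gt: "real d - c * real (card (ins x)) < real (card (ins v \<inter> rest x))"
    using obtain_low_in[OF x] .
  \<comment> \<open>Any arc from \<open>outs x\<close> into \<open>P\<close> completes a 4-cycle
    through \<open>x\<close> and the fixed \<open>v\<close>.\<close>
  define P where "P = ins v \<inter> rest x"
  have "outs x \<subseteq> V" "k \<le> card (outs x)"
    using outs_ge[OF x] k by (auto simp: outs_def)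
  then obtain U where U: "U \<subseteq> outs x" "card U = k"
    and sum_U: "(\<Sum>u\<in>U. real (card {w \<in> outs x. r u w})) \<le>
      c * real k * real (card (outs x)) + (1 - c) * real k * (real k - 1) / 2"
    using exists_low_out_degree_subset[of "outs x" r c k] low_out by (meson finite_nbhds(1) order_trans)
  \<comment> \<open>Out-neighbours of \<open>u\<close> outside \<open>outs x\<close> lie in
    \<open>rest x\<close>, and only those in \<open>rest x - P\<close> miss
    \<open>P\<close>.\<close>
  have "real d - real (card {w \<in> outs x. r u w}) - (real (card (rest x)) - real (card P)) \<le>
      real (card (outs u \<inter> P))" if "u \<in> U" for u
  proof -
    have u: "u \<in> outs x" using that U by blast
    have "d \<le> card (outs u)"
      using u by (intro outs_ge) (auto simp: outs_def)
    also have "\<dots> \<le> card ({w \<in> outs x. r u w} \<union> (outs u \<inter> P \<union> (rest x - P)))"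
      using outs_subset[OF x u] by (intro card_mono) (auto simp: P_def)
    also have "\<dots> \<le> card {w \<in> outs x. r u w} + card (outs u \<inter> P \<union> (rest x - P))"
      by (rule card_Un_le)
    also have "\<dots> \<le> card {w \<in> outs x. r u w} + (card (outs u \<inter> P) + card (rest x - P))"
      using card_Un_le by simp
    finally have "d \<le> card {w \<in> outs x. r u w} + (card (outs u \<inter> P) + card (rest x - P))" .
    moreover have "card (rest x - P) = card (rest x) - card P" "card P \<le> card (rest x)"
      by (auto simp: P_def intro!: card_Diff_subset card_mono)
    ultimately show ?thesis by linarith
  qed
  then have "(\<Sum>u\<in>U. real d - real (card {w \<in> outs x. r u w}) - (real (card (rest x)) - real (card P)))
      \<le> (\<Sum>u\<in>U. real (card (outs u \<inter> P)))"
    by (rule sum_mono)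
  moreover have "(\<Sum>u\<in>U. real d - real (card {w \<in> outs x. r u w}) - (real (card (rest x)) - real (card P)))
      = real k * (real d - real (card (rest x)) + real (card P)) - (\<Sum>u\<in>U. real (card {w \<in> outs x. r u w}))"
    using U(2) by (simp add: sum_subtractf right_diff_distrib distrib_left)
  \<comment> \<open>After substituting \<open>card_rest\<close>, both neighbourhood sizes carry the
    coefficient \<open>1 - c\<close>, so each may be replaced by \<open>d\<close>.\<close>
  moreover have "real k * (2 * real d + 2 * (1 - c) * real d + 1 - real (card V)) <
      real k * (real d - real (card (rest x)) + real (card P)) - c * real k * real (card (outs x))"
  proof -
    have "(1 - c) * real d \<le> (1 - c) * real (card (ins x))" "(1 - c) * real d \<le> (1 - c) * real (card (outs x))"
      using ins_ge[OF x] outs_ge[OF x] c_le_1 by (auto intro!: mult_left_mono)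
    then have "2 * real d + 2 * (1 - c) * real d + 1 - real (card V) <
        real d - real (card (rest x)) + real (card P) - c * real (card (outs x))"
      using v_gt card_rest[OF x] unfolding P_def by (simp add: algebra_simps)
    then have "real k * (2 * real d + 2 * (1 - c) * real d + 1 - real (card V)) <
        real k * (real d - real (card (rest x)) + real (card P) - c * real (card (outs x)))"
      using k by (intro mult_strict_left_mono) auto
    then show ?thesis by (simp add: algebra_simps)
  qed
  ultimately have "real k * (2 * real d + 2 * (1 - c) * real d + 1 - real (card V)) - (1 - c) * real k * (real k - 1) / 2
      < (\<Sum>u\<in>U. real (card (outs u \<inter> P)))"
    using sum_U by linarith
  also have "\<dots> = real (card (SIGMA u:U. outs u \<inter> P))"
    using finite_subset[OF U(1)] by simp
  also have "\<dots> \<le> real (card {(u, w, v). u \<in> outs x \<and> w \<in> outs u \<and> v \<in> outs w \<and> x \<in> outs v})"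
  proof (intro of_nat_mono card_inj_on_le)
    show "inj_on (\<lambda>(u, w). (u, w, v)) (SIGMA u:U. outs u \<inter> P)"
      by (auto simp: inj_on_def)
    show "(\<lambda>(u, w). (u, w, v)) ` (SIGMA u:U. outs u \<inter> P) \<subseteq>
        {(u, w, v). u \<in> outs x \<and> w \<in> outs u \<and> v \<in> outs w \<and> x \<in> outs v}"
      using U(1) v x by (auto simp: P_def outs_def ins_def)
    show "finite {(u, w, v). u \<in> outs x \<and> w \<in> outs u \<and> v \<in> outs w \<and> x \<in> outs v}"
      by (rule finite_subset[of _ "V \<times> V \<times> V"]) (use fin in \<open>auto simp: outs_def\<close>)
  qed
  finally show ?thesis .
qed

end

section \<open>From vertex triples to 4-cycles as arc sets\<close>

text \<open>Following the arcs of a 4-cycle from \<open>x\<close> recovers \<open>u\<close>,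
  \<open>w\<close> and \<open>v\<close> in turn, so distinct triples give distinct arc sets.\<close>

lemma (in digraph) card_dicycles_through_4_ge:
  assumes free: "no_short_dicycle (verts G) (dominates G)"
  shows "card {(u, w, v). x \<rightarrow> u \<and> u \<rightarrow> w \<and> w \<rightarrow> v \<and> v \<rightarrow> x} \<le> card (dicycles_through G 4 x)"
proof (rule card_inj_on_le)
  let ?T = "{(u, w, v). x \<rightarrow> u \<and> u \<rightarrow> w \<and> w \<rightarrow> v \<and> v \<rightarrow> x}"
  let ?E = "\<lambda>(u, w, v). {(x, u), (u, w), (w, v), (v, x)}"
  let ?g = "\<lambda>p. {e \<in> arcs G. arc_to_ends G e \<in> ?E p}"
  \<comment> \<open>If two opposite vertices coincided, there would be a 2-cycle.\<close>
  have distinct: "distinct [x, u, w, v]" if "x \<rightarrow> u" "u \<rightarrow> w" "w \<rightarrow> v" "v \<rightarrow> x" for u w v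
    using that no_short_dicycle_antisym[OF free] adj_not_same adj_in_verts
    by (metis distinct_length_2_or_more distinct_singleton)
  show "inj_on ?g ?T"
  proof (rule inj_onI)
    fix p p' assume "p \<in> ?T" "p' \<in> ?T" and eq: "?g p = ?g p'"
    then obtain u w v u' w' v' where pp: "p = (u, w, v)" "p' = (u', w', v')"
      and p: "x \<rightarrow> u" "u \<rightarrow> w" "w \<rightarrow> v" "v \<rightarrow> x" and p': "x \<rightarrow> u'" "u' \<rightarrow> w'" "w' \<rightarrow> v'" "v' \<rightarrow> x"
      by blast
    have ends: "arc_to_ends G ` {e \<in> arcs G. arc_to_ends G e \<in> S} = S" if "S \<subseteq> arcs_ends G" for S
      using that unfolding arcs_ends_def by blast
    have "?E p \<subseteq> arcs_ends G" "?E p' \<subseteq> arcs_ends G"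
      using p p' unfolding pp by simp_all
    then have E: "?E p = ?E p'"
      using arg_cong[OF eq, of "image (arc_to_ends G)"] by (simp only: ends)
    have "{(x, u), (u, w), (w, v)} \<subseteq> ?E p"
      unfolding pp by simp
    also note E
    finally show "p = p'"
      unfolding pp using distinct[OF p] distinct[OF p'] by auto
  qed
  show "?g ` ?T \<subseteq> dicycles_through G 4 x"
  proof (rule image_subsetI)
    fix p assume "p \<in> ?T"
    then obtain u w v where pp: "p = (u, w, v)" and p: "x \<rightarrow> u" "u \<rightarrow> w" "w \<rightarrow> v" "v \<rightarrow> x"
      by blast
    have ex_arc: "\<exists>e \<in> arcs G. arc_to_ends G e = (a, b)" if "a \<rightarrow> b" for a b
      using that unfolding arcs_ends_def by force
    obtain e f g h where es: "e \<in> arcs G" "arc_to_ends G e = (x, u)" "f \<in> arcs G" "arc_to_ends G f = (u, w)"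
      "g \<in> arcs G" "arc_to_ends G g = (w, v)" "h \<in> arcs G" "arc_to_ends G h = (v, x)"
      using p[THEN ex_arc] by blast
    have "{a \<in> arcs G. arc_to_ends G a = arc_to_ends G b} = {b}" if "b \<in> arcs G" for b
      using that no_multi_arcs by blast
    note this[OF es(1)] this[OF es(3)] this[OF es(5)] this[OF es(7)]
    moreover have "?g p = {a \<in> arcs G. arc_to_ends G a = arc_to_ends G e} \<union> {a \<in> arcs G. arc_to_ends G a = arc_to_ends G f}
        \<union> {a \<in> arcs G. arc_to_ends G a = arc_to_ends G g} \<union> {a \<in> arcs G. arc_to_ends G a = arc_to_ends G h}"
      unfolding pp es by auto
    ultimately have "?g p = set [e, f, g, h]"
      by auto
    moreover have "cycle [e, f, g, h]"
      using es distinct[OF p] adj_in_verts[OF p(1)] unfolding cycle_iff_cas by (auto simp: arc_to_ends_def)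
    moreover have "x \<in> tail G ` set [e, f, g, h]"
      using es by (auto simp: arc_to_ends_def)
    ultimately show "?g p \<in> dicycles_through G 4 x"
      unfolding dicycles_through_def dicycles_def by (intro CollectI conjI exI[of _ "[e, f, g, h]"]) auto
  qed
  have "dicycles_through G 4 x \<subseteq> Pow (arcs G)"
    by (auto simp: dicycles_through_def dicycles_def cycle_iff_cas)
  then show "finite (dicycles_through G 4 x)"
    by (rule finite_subset) simp
qed

section \<open>Comparison of the rational bound with the counts\<close>

text \<open>The right-hand side is the coefficient of \<open>d\<close> in the count for
  \<open>k = 4\<close>; the lower limit on \<open>m\<close> comes from
  \<open>order_gt\<close>.\<close>

lemma bound_le_four:
  fixes c m :: real
  assumes c: "1/3 \<le> c" "c \<le> 1/2" and m: "3 - c \<le> m" "m \<le> 3"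
  shows "(11 - 15 * c + 7 * c\<^sup>2 - c ^ 3 - (c\<^sup>2 - 3 * c + 3) * m) / ((1 - c)\<^sup>2 * (2 - c))
    \<le> 4 * (2 + 2 * (1 - c) - m)"
proof -
  \<comment> \<open>In terms of the distance of \<open>c\<close> from its upper bound, both endpoint
    values below are polynomials with nonnegative coefficients.\<close>
  define y where "y = 1/2 - c"
  have c_eq: "c = 1/2 - y" and y: "0 \<le> y" "y \<le> 1/6" using c by (auto simp: y_def)
  define f where "f = (\<lambda>m. 4 * (2 + 2 * (1 - c) - m) * ((1 - c)\<^sup>2 * (2 - c))
     - (11 - 15 * c + 7 * c\<^sup>2 - c ^ 3 - (c\<^sup>2 - 3 * c + 3) * m))"
  \<comment> \<open>\<open>f\<close> is affine in \<open>m\<close>, so its two endpoint values decide\<close>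
  have "f (3 - c) = 4 * y * (1/2 + y) * (3/2 + y) * (1 + y)"
    unfolding f_def c_eq by (simp add: field_simps power2_eq_square power3_eq_cube)
  then have "0 \<le> f (3 - c)" using y by simp
  moreover have "f 3 = 8 * y ^ 4 + 19 * y ^ 3 + 23/2 * y\<^sup>2 + y / 4 + 1/8"
    unfolding f_def c_eq by (simp add: field_simps eval_nat_numeral)
  then have "0 \<le> f 3" using y by simp
  moreover have "c * f m = (3 - m) * f (3 - c) + (m - (3 - c)) * f 3"
    unfolding f_def by (simp add: algebra_simps)
  ultimately have "0 \<le> c * f m" using m by simp
  then have "0 \<le> f m" using c by (simp add: zero_le_mult_iff)
  moreover have "0 < (1 - c)\<^sup>2 * (2 - c)" using c by simp
  ultimately show ?thesis
    unfolding f_def by (simp add: divide_le_eq)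
qed

text \<open>The right-hand side is one third of the count for \<open>k = 3\<close>,
  \<open>d = 3\<close>, \<open>m = 3\<close>; the summand \<open>c\<close> is
  \<open>(3 - 3 * (1 - c)) / 3\<close>, left over from the terms free of \<open>d\<close>.\<close>

lemma bound_le_three:
  fixes c :: real
  assumes c: "1/3 \<le> c" "c \<le> 1/2"
  shows "(11 - 15 * c + 7 * c\<^sup>2 - c ^ 3 - (c\<^sup>2 - 3 * c + 3) * 3) / ((1 - c)\<^sup>2 * (2 - c))
    \<le> 3 * (2 + 2 * (1 - c) - 3) + c"
proof -
  define y where "y = 1/2 - c"
  have c_eq: "c = 1/2 - y" and y: "0 \<le> y" "y \<le> 1/6" using c by (auto simp: y_def)
  have "(3 * (2 + 2 * (1 - c) - 3) + c) * ((1 - c)\<^sup>2 * (2 - c)) -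
      (11 - 15 * c + 7 * c\<^sup>2 - c ^ 3 - (c\<^sup>2 - 3 * c + 3) * 3) =
      5 * y ^ 4 + 12 * y ^ 3 + 15/2 * y\<^sup>2 + 5/16"
    unfolding c_eq by (simp add: field_simps eval_nat_numeral)
  also have "\<dots> \<ge> 0" using y by simp
  finally have "11 - 15 * c + 7 * c\<^sup>2 - c ^ 3 - (c\<^sup>2 - 3 * c + 3) * 3 \<le>
      (3 * (2 + 2 * (1 - c) - 3) + c) * ((1 - c)\<^sup>2 * (2 - c))" by simp
  moreover have "0 < (1 - c)\<^sup>2 * (2 - c)" using c by simp
  ultimately show ?thesis
    by (simp add: divide_le_eq)
qed

section \<open>Combination of the estimates by cases on \<open>d\<close>\<close>

theorem theorem1p6:
  fixes D :: "('a, 'b) pre_digraph" and d :: nat and m c :: real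
  defines "c \<equiv> ch_const"
  assumes "d \<ge> 1"
    and "oriented_graph D"
    and "dicycles D 3 = {}"
    and "min_semidegree D = d"
    and "real (card (verts D)) = m * real d"
    and "m \<le> 3"
  shows "\<forall>x \<in> verts D.
    real (card (dicycles_through D 4 x)) >
      (11 - 15 * c + 7 * c\<^sup>2 - c ^ 3 - (c\<^sup>2 - 3 * c + 3) * m) / ((1 - c)\<^sup>2 * (2 - c)) * real d"
proof
  fix x assume x: "x \<in> verts D"
  interpret oriented_graph D by fact
  note d = \<open>d \<ge> 1\<close> and card_V = \<open>real (card (verts D)) = m * real d\<close> and m = \<open>m \<le> 3\<close>
  define bound where "bound = (11 - 15 * c + 7 * c\<^sup>2 - c ^ 3 - (c\<^sup>2 - 3 * c + 3) * m) / ((1 - c)\<^sup>2 * (2 - c))"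
  have free: "no_short_dicycle (verts D) (dominates D)"
    unfolding no_short_dicycle_def
    using antisym_arcs adj_not_same dicycles_3_nonempty \<open>dicycles D 3 = {}\<close> by metis
  have out_ge: "d \<le> card {w \<in> verts D. u \<rightarrow>\<^bsub>D\<^esub> w}" if "u \<in> verts D" for u
  proof -
    have "d \<le> min_out_degree D"
      using \<open>min_semidegree D = d\<close> by (auto simp: min_semidegree_def)
    also have "\<dots> \<le> out_degree D u"
      unfolding min_out_degree_def using that by (intro Min_le) auto
    finally show ?thesis by (simp add: out_degree_conv_card)
  qed
  have in_ge: "d \<le> card {w \<in> verts D. w \<rightarrow>\<^bsub>D\<^esub> u}" if "u \<in> verts D" for u
  proof -
    have "d \<le> min_in_degree D"
      using \<open>min_semidegree D = d\<close> by (auto simp: min_semidegree_def)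
    also have "\<dots> \<le> in_degree D u"
      unfolding min_in_degree_def using that by (intro Min_le) auto
    finally show ?thesis by (simp add: in_degree_conv_card)
  qed
  have forces: "forces_short_dicycle c"
    unfolding c_def by (rule forces_short_dicycle_ch_const)
  have c_le: "c \<le> 1/2"
    unfolding c_def by (rule ch_const_le[OF forces_short_dicycle_half])
  \<comment> \<open>\<open>D\<close> itself witnesses this: it has no short cycle, all out-degrees
    are at least \<open>d\<close>, and its order is at most \<open>3 * d\<close>.\<close>
  have c_gt: "1/3 < c"
  proof -
    obtain u where "u \<in> verts D" "real (card {w \<in> verts D. u \<rightarrow>\<^bsub>D\<^esub> w}) < c * real (card (verts D))"
      using forces_short_dicycleD[OF forces finite_verts _ free] x by blast
    then have "real d < c * (m * real d)"
      using out_ge[of u] by (simp flip: card_V)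
    moreover have "0 < c"
      using forces_short_dicycle_gt_quarter[OF forces] by simp
    then have "c * (m * real d) \<le> c * (3 * real d)"
      using m by (intro mult_left_mono mult_right_mono) auto
    ultimately have "1 * real d < (3 * c) * real d"
      by simp
    then show ?thesis
      using d by simp
  qed
  interpret low_degree_relation "verts D" "dominates D" c d
  proof
    fix W assume W: "W \<subseteq> verts D" "W \<noteq> {}"
    then have fin_W: "finite W"
      by (meson finite_verts finite_subset)
    show "\<exists>u\<in>W. real (card {w \<in> W. u \<rightarrow>\<^bsub>D\<^esub> w}) < c * real (card W)"
      by (rule forces_short_dicycleD[OF forces fin_W W(2) no_short_dicycle_subset[OF free W(1)]])
    \<comment> \<open>Forcing is about out-degrees, so it is applied to the converse
      relation.\<close>
    show "\<exists>u\<in>W. real (card {w \<in> W. w \<rightarrow>\<^bsub>D\<^esub> u}) < c * real (card W)"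
      by (rule forces_short_dicycleD[OF forces fin_W W(2)
            no_short_dicycle_converse[OF no_short_dicycle_subset[OF free W(1)]]])
  qed (use free out_ge in_ge d c_le in auto)
  have "{(u, w, v). u \<in> outs x \<and> w \<in> outs u \<and> v \<in> outs w \<and> x \<in> outs v} =
      {(u, w, v). x \<rightarrow>\<^bsub>D\<^esub> u \<and> u \<rightarrow>\<^bsub>D\<^esub> w \<and> w \<rightarrow>\<^bsub>D\<^esub> v \<and> v \<rightarrow>\<^bsub>D\<^esub> x}"
    using adj_in_verts by (auto simp: outs_def)
  then have cycles_gt: "real k * (2 * real d + 2 * (1 - c) * real d + 1 - m * real d) - (1 - c) * real k * (real k - 1) / 2
      < real (card (dicycles_through D 4 x))" if "1 \<le> k" "k \<le> d" for k
    using card_four_cycles_gt[OF x that] card_dicycles_through_4_ge[OF free, of x] card_V by simp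
  have order: "1 + (3 - c) * real d < m * real d"
    using order_gt[OF x] card_V by simp
  have "bound * real d < real (card (dicycles_through D 4 x))"
  proof (cases "4 \<le> d")
    case True
    have "(3 - c) * real d \<le> m * real d"
      using order by simp
    then have "3 - c \<le> m"
      using d by simp
    then have "bound * real d \<le> 4 * (2 + 2 * (1 - c) - m) * real d"
      unfolding bound_def using c_gt c_le m by (intro mult_right_mono bound_le_four) auto
    \<comment> \<open>For \<open>k = 4\<close> the terms free of \<open>d\<close> are
      \<open>4 - 6 * (1 - c) = 6 * c - 2\<close>, positive by \<open>c_gt\<close>.\<close>
    then show ?thesis
      using cycles_gt[of 4] True c_gt by (simp add: field_simps)
  next
    case False
    have "m * real d \<le> 3 * real d"
      using m by (intro mult_right_mono) auto
    then have "1 < c * real d"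
      using order by (simp add: algebra_simps)
    also have "\<dots> \<le> 1/2 * real d"
      using c_le by (intro mult_right_mono) auto
    finally have d3: "d = 3"
      using False by simp
    \<comment> \<open>For \<open>d = 3\<close> the lower bound \<open>1 + 3 * (3 - c)\<close> on the
      order is at least \<open>17/2\<close>.\<close>
    then have "8 < real (card (verts D))" "real (card (verts D)) \<le> 9"
      using order c_le m card_V by simp_all
    then have "card (verts D) = 9" by linarith
    then have m3: "m = 3"
      using card_V d3 by simp
    have "bound \<le> 3 * (2 + 2 * (1 - c) - 3) + c"
      unfolding bound_def m3 using c_gt c_le by (intro bound_le_three) auto
    then show ?thesis
      using cycles_gt[of 3] d3 m3 by (simp add: field_simps)
  qed
  then show "real (card (dicycles_through D 4 x)) >
      (11 - 15 * c + 7 * c\<^sup>2 - c ^ 3 - (c\<^sup>2 - 3 * c + 3) * m) / ((1 - c)\<^sup>2 * (2 - c)) * real d"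
    unfolding bound_def .
qed

end
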